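(* Let $k\geq 0$ and $t\geq 2$ be integers and let $T$ be a tournament with $n$ vertices and irregularity $i(T)\leq k$. If $n\geq 6t+5k$, then $\kappa_{s}^{*}(T)\geq t$; that is, $T$ is $\omega^{*}$-strongly connected for every $1\leq\omega\leq t$.
   Context: A tournament is a digraph in which each pair of distinct vertices is joined by exactly one arc. The irregularity $i(T)$ of a tournament $T$ is $\max_{x\in V(T)}|d^{+}(x)-d^{-}(x)|$, where $d^{+},d^{-}$ denote out- and in-degree. For distinct vertices $u,v$ of a digraph $D$, a strong $k^{*}$-container between $u$ and $v$ is a set of $k$ internally disjoint paths that are either all $(u,v)$-paths or all $(v,u)$-paths, whose union contains every vertex of $D$. $D$ is $k^{*}$-strongly connected if there is a strong $k^{*}$-container between every two distinct vertices of $D$. If $D$ is $1^{*}$-strongly connected, the strong spanning connectivity $\kappa_{s}^{*}(D)$ is the largest integer $k$ such that $D$ is $\omega^{*}$-strongly connected for all $1\leq\omega\leq k$. *)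

theory Defs
  imports Main
begin

definition tournament :: "'a set \<Rightarrow> ('a \<times> 'a) set \<Rightarrow> bool" where
  "tournament V E \<longleftrightarrow> finite V \<and> E \<subseteq> V \<times> V \<and> (\<forall>x\<in>V. (x, x) \<notin> E) \<and>
     (\<forall>x\<in>V. \<forall>y\<in>V. x \<noteq> y \<longrightarrow> ((x, y) \<in> E \<longleftrightarrow> (y, x) \<notin> E))"

definition out_deg :: "'a set \<Rightarrow> ('a \<times> 'a) set \<Rightarrow> 'a \<Rightarrow> nat" where
  "out_deg V E x = card {y \<in> V. (x, y) \<in> E}"

definition in_deg :: "'a set \<Rightarrow> ('a \<times> 'a) set \<Rightarrow> 'a \<Rightarrow> nat" where
  "in_deg V E x = card {y \<in> V. (y, x) \<in> E}"

definition irregularity :: "'a set \<Rightarrow> ('a \<times> 'a) set \<Rightarrow> nat" where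
  "irregularity V E = Max (insert 0 ((\<lambda>x. nat \<bar>int (out_deg V E x) - int (in_deg V E x)\<bar>) ` V))"

definition is_path :: "'a set \<Rightarrow> ('a \<times> 'a) set \<Rightarrow> 'a \<Rightarrow> 'a \<Rightarrow> 'a list \<Rightarrow> bool" where
  "is_path V E u v p \<longleftrightarrow> p \<noteq> [] \<and> hd p = u \<and> last p = v \<and> distinct p \<and> set p \<subseteq> V \<and>
     (\<forall>i. Suc i < length p \<longrightarrow> (p ! i, p ! Suc i) \<in> E)"

definition internal_vertices :: "'a list \<Rightarrow> 'a set" where
  "internal_vertices p = set (butlast (tl p))"

definition container_from :: "'a set \<Rightarrow> ('a \<times> 'a) set \<Rightarrow> nat \<Rightarrow> 'a \<Rightarrow> 'a \<Rightarrow> 'a list list \<Rightarrow> bool" where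
  "container_from V E k u v Ps \<longleftrightarrow> length Ps = k \<and> distinct Ps \<and>
     (\<forall>p\<in>set Ps. is_path V E u v p) \<and>
     (\<forall>i<k. \<forall>j<k. i \<noteq> j \<longrightarrow> internal_vertices (Ps ! i) \<inter> internal_vertices (Ps ! j) = {}) \<and>
     (\<Union>p\<in>set Ps. set p) = V"

definition strong_container :: "'a set \<Rightarrow> ('a \<times> 'a) set \<Rightarrow> nat \<Rightarrow> 'a \<Rightarrow> 'a \<Rightarrow> bool" where
  "strong_container V E k u v \<longleftrightarrow>
     (\<exists>Ps. container_from V E k u v Ps) \<or> (\<exists>Ps. container_from V E k v u Ps)"

definition k_strongly_connected :: "'a set \<Rightarrow> ('a \<times> 'a) set \<Rightarrow> nat \<Rightarrow> bool" where
  "k_strongly_connected V E k \<longleftrightarrow>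
     (\<forall>u\<in>V. \<forall>v\<in>V. u \<noteq> v \<longrightarrow> strong_container V E k u v)"

end

theory Submission
  imports Defs
begin

text \<open>Deleting \<open>u\<close> and \<open>v\<close> turns a container of paths from \<open>u\<close> to \<open>v\<close> into a partition of
  \<open>X = V - {u, v}\<close> into vertex-disjoint paths that start in \<open>S = N\<^sup>+(u)\<close> and end in \<open>R = N\<^sup>-(v)\<close>.
  Two disjoint such paths of a tournament can always be merged into one on the same vertices, so
  it is enough to cover \<open>X\<close> by at least \<open>\<omega>\<close> paths.

  Among all systems of at least \<open>\<omega> + 2\<close> disjoint paths take one that covers a maximal set, and let
  \<open>W\<close> be the uncovered rest. As \<open>T - u\<close> and \<open>T - v\<close> are strong, \<open>W\<close> contains no vertex of \<open>S\<close> or \<open>R\<close>,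
  and \<open>W\<close> has a Hamiltonian path \<open>L\<close> whose first vertex is dominated by the end of some path \<open>P\<close> and
  whose last vertex dominates the start of some path \<open>Q\<close>. If \<open>P \<noteq> Q\<close>, then \<open>P L Q\<close> is a path; otherwise
  \<open>L\<close> is cut in two and absorbed with the help of two further paths. At most two paths are lost.

  That \<open>\<omega> + 2\<close> disjoint paths exist follows by counting degrees around a system with the
  largest number of paths.\<close>

text \<open>Unlike \<open>tournament\<close>, \<open>tour\<close> does not require \<open>E \<subseteq> W \<times> W\<close>, so that it is inherited by
  subsets of \<open>W\<close> with the same \<open>E\<close>.\<close>

definition tour :: "'a set \<Rightarrow> ('a \<times> 'a) set \<Rightarrow> bool" where
  "tour W E \<longleftrightarrow> finite W \<and> (\<forall>x\<in>W. (x, x) \<notin> E) \<and>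
     (\<forall>x\<in>W. \<forall>y\<in>W. x \<noteq> y \<longrightarrow> ((x, y) \<in> E \<longleftrightarrow> (y, x) \<notin> E))"

abbreviation walk :: "('a \<times> 'a) set \<Rightarrow> 'a list \<Rightarrow> bool" where
  "walk E \<equiv> successively (\<lambda>x y. (x, y) \<in> E)"

text \<open>One-vertex lists are allowed: \<open>x\<close> in \<open>S \<inter> R\<close> gives
  \<open>[x]\<close>, which stands for the path \<open>u\<close>, \<open>x\<close>,
  \<open>v\<close>.\<close>

definition path_between :: "'a set \<Rightarrow> ('a \<times> 'a) set \<Rightarrow> 'a set \<Rightarrow> 'a set \<Rightarrow> 'a list \<Rightarrow> bool" where
  "path_between X E S R P \<longleftrightarrow>
     P \<noteq> [] \<and> distinct P \<and> set P \<subseteq> X \<and> walk E P \<and> hd P \<in> S \<and> last P \<in> R"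

definition path_system ::
  "'a set \<Rightarrow> ('a \<times> 'a) set \<Rightarrow> 'a set \<Rightarrow> 'a set \<Rightarrow> 'a list set \<Rightarrow> bool" where
  "path_system X E S R F \<longleftrightarrow> finite F \<and> (\<forall>P\<in>F. path_between X E S R P) \<and>
     (\<forall>P\<in>F. \<forall>Q\<in>F. P \<noteq> Q \<longrightarrow> set P \<inter> set Q = {})"

abbreviation cover :: "'a list set \<Rightarrow> 'a set" where
  "cover F \<equiv> \<Union> (set ` F)"

text \<open>Equivalently: from every vertex of \<open>X\<close> the set \<open>R\<close> can be reached within \<open>X\<close>.\<close>

definition absorbing :: "'a set \<Rightarrow> ('a \<times> 'a) set \<Rightarrow> 'a set \<Rightarrow> bool" where
  "absorbing X E R \<longleftrightarrow>
     (\<forall>Z\<subseteq>X. Z \<noteq> {} \<longrightarrow> (\<forall>z\<in>Z. \<forall>y\<in>X - Z. (z, y) \<notin> E) \<longrightarrow> Z \<inter> R \<noteq> {})"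

section \<open>Elementary facts on tournaments, reversal and exchange of paths\<close>

lemma absorbingD:
  assumes "absorbing X E R" "Z \<subseteq> X" "Z \<noteq> {}"
    and "\<And>z y. z \<in> Z \<Longrightarrow> y \<in> X - Z \<Longrightarrow> (z, y) \<notin> E"
  shows "Z \<inter> R \<noteq> {}"
  using assms by (simp add: absorbing_def)

lemma tour_subset: "tour W E \<Longrightarrow> Z \<subseteq> W \<Longrightarrow> tour Z E"
  unfolding tour_def by (meson finite_subset subset_iff)

lemma tour_converse: "tour W E \<Longrightarrow> tour W (E\<inverse>)"
  unfolding tour_def by blast

lemma tour_arc_iff: "tour W E \<Longrightarrow> x \<in> W \<Longrightarrow> y \<in> W \<Longrightarrow> x \<noteq> y \<Longrightarrow> (x, y) \<in> E \<longleftrightarrow> (y, x) \<notin> E"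
  unfolding tour_def by blast

lemma tour_finite: "tour W E \<Longrightarrow> finite W"
  unfolding tour_def by blast

lemma tour_if_tournament: "tournament V E \<Longrightarrow> tour V E"
  unfolding tournament_def tour_def by blast

lemma tour_asym: "tour W E \<Longrightarrow> x \<in> W \<Longrightarrow> y \<in> W \<Longrightarrow> (x, y) \<in> E \<Longrightarrow> (y, x) \<notin> E"
  unfolding tour_def by metis

lemma path_between_rev:
  assumes "path_between X E S R P"
  shows "path_between X (E\<inverse>) R S (rev P)"
  using assms unfolding path_between_def by (auto simp: hd_rev last_rev)

text \<open>Reversing all arcs swaps the roles of \<open>S\<close> and \<open>R\<close>, so facts
  about starts of paths transfer to ends.\<close>

lemma path_system_rev:
  assumes "path_system X E S R F"
  shows "path_system X (E\<inverse>) R S (rev ` F)"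
  unfolding path_system_def
proof (intro conjI ballI impI)
  show "finite (rev ` F)" using assms by (simp add: path_system_def)
next
  fix P assume "P \<in> rev ` F"
  then show "path_between X (E\<inverse>) R S P"
    using assms path_between_rev unfolding path_system_def by blast
next
  fix P Q assume "P \<in> rev ` F" "Q \<in> rev ` F" "P \<noteq> Q"
  then obtain P' Q' where "P' \<in> F" "Q' \<in> F" "P' \<noteq> Q'" "P = rev P'" "Q = rev Q'" by blast
  then show "set P \<inter> set Q = {}"
    using assms unfolding path_system_def by simp
qed

lemma cover_rev [simp]: "cover (rev ` F) = cover F"
  by auto

lemma card_rev_image [simp]: "card (rev ` F) = card F"
  by (intro card_image) (auto simp: inj_on_def)

text \<open>The count is exact because \<open>P\<close>, being nonempty and disjoint from the rest,
  is not in \<open>F - G\<close>. With \<open>G = {}\<close> a path is added.\<close>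

lemma path_system_exchange:
  assumes F: "path_system X E S R F" and G: "G \<subseteq> F" and P: "path_between X E S R P"
    and disj: "set P \<inter> cover (F - G) = {}"
  shows "path_system X E S R (insert P (F - G))"
    and "card (insert P (F - G)) = card F - card G + 1"
proof -
  have "P \<noteq> []" using P by (simp add: path_between_def)
  then have "P \<notin> F - G" using disj by (metis Int_absorb2 Sup_upper image_eqI set_empty)
  moreover have "finite F" using F by (simp add: path_system_def)
  ultimately show "card (insert P (F - G)) = card F - card G + 1"
    using G by (simp add: card_Diff_subset finite_subset)
  show "path_system X E S R (insert P (F - G))"
    unfolding path_system_def
  proof (intro conjI ballI impI)
    fix Q1 Q2 assume "Q1 \<in> insert P (F - G)" "Q2 \<in> insert P (F - G)" "Q1 \<noteq> Q2"
    then consider "Q1 = P" "Q2 \<in> F - G" | "Q2 = P" "Q1 \<in> F - G" | "Q1 \<in> F" "Q2 \<in> F"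
      by blast
    then show "set Q1 \<inter> set Q2 = {}"
      using F disj \<open>Q1 \<noteq> Q2\<close> unfolding path_system_def by cases blast+
  qed (use F P in \<open>auto simp: path_system_def\<close>)
qed

lemma path_systemD:
  assumes "path_system X E S R F"
  shows "finite F" "P \<in> F \<Longrightarrow> path_between X E S R P"
    "P \<in> F \<Longrightarrow> Q \<in> F \<Longrightarrow> P \<noteq> Q \<Longrightarrow> set P \<inter> set Q = {}"
  using assms by (simp_all add: path_system_def)

lemma path_betweenD:
  assumes "path_between X E S R P"
  shows "P \<noteq> []" "distinct P" "set P \<subseteq> X" "walk E P" "hd P \<in> S" "last P \<in> R"
  using assms by (simp_all add: path_between_def)

lemma path_system_cover_subset: "path_system X E S R F \<Longrightarrow> cover F \<subseteq> X"
  by (intro UN_least path_betweenD(3) path_systemD(2))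

lemma path_system_cover_Diff:
  assumes "path_system X E S R F" "G \<subseteq> F"
  shows "cover (F - G) = cover F - cover G"
proof -
  have disj: "set P \<inter> set Q = {}" if "P \<in> F - G" "Q \<in> G" for P Q
    using path_systemD(3)[OF assms(1), of P Q] assms(2) that by auto
  show ?thesis
  proof
    show "cover (F - G) \<subseteq> cover F - cover G" using disj by blast
    show "cover F - cover G \<subseteq> cover (F - G)" by blast
  qed
qed

subsection \<open>Merging and inserting paths\<close>

text \<open>As in merge sort: of the two first vertices the dominating one goes in front, and it
  dominates whichever vertex the merge of the rest begins with.\<close>

lemma merge_paths:
  assumes "tour X E" "P \<noteq> []" "Q \<noteq> []" "distinct P" "distinct Q" "set P \<inter> set Q = {}"
    "set P \<subseteq> X" "set Q \<subseteq> X" "walk E P" "walk E Q"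
  shows "\<exists>M. M \<noteq> [] \<and> distinct M \<and> set M = set P \<union> set Q \<and> walk E M \<and>
           hd M \<in> {hd P, hd Q} \<and> last M \<in> {last P, last Q}"
  using assms(2-)
proof (induction "length P + length Q" arbitrary: P Q rule: less_induct)
  case less
  have main: "\<exists>M. M \<noteq> [] \<and> distinct M \<and> set M = set P' \<union> set Q' \<and> walk E M \<and>
           hd M \<in> {hd P', hd Q'} \<and> last M \<in> {last P', last Q'}"
    if len: "length P' + length Q' = length P + length Q"
      and *: "P' \<noteq> []" "Q' \<noteq> []" "distinct P'" "distinct Q'" "set P' \<inter> set Q' = {}"
        "set P' \<subseteq> X" "set Q' \<subseteq> X" "walk E P'" "walk E Q'"
      and arc: "(hd P', hd Q') \<in> E" for P' Q'
  proof -
    obtain p P1 where P': "P' = p # P1" using * by (cases P') auto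
    show ?thesis
    proof (cases "P1 = []")
      case True
      then show ?thesis
        using * arc P' by (intro exI[of _ "p # Q'"]) (auto simp: successively_Cons)
    next
      case False
      have "\<exists>M. M \<noteq> [] \<and> distinct M \<and> set M = set P1 \<union> set Q' \<and> walk E M \<and>
           hd M \<in> {hd P1, hd Q'} \<and> last M \<in> {last P1, last Q'}"
        by (rule less.hyps) (use * False P' len in \<open>auto simp: successively_Cons\<close>)
      then obtain M where M: "M \<noteq> []" "distinct M" "set M = set P1 \<union> set Q'" "walk E M"
           "hd M \<in> {hd P1, hd Q'}" "last M \<in> {last P1, last Q'}" by blast
      then show ?thesis
        using * arc P' False by (intro exI[of _ "p # M"]) (auto simp: successively_Cons)
    qed
  qed
  have "hd P \<in> X" "hd Q \<in> X" "hd P \<noteq> hd Q"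
    using less.prems by (auto dest: hd_in_set)
  then consider "(hd P, hd Q) \<in> E" | "(hd Q, hd P) \<in> E"
    using tour_arc_iff[OF assms(1)] by blast
  then show ?case
  proof cases
    case 1
    then show ?thesis using main[of P Q] less.prems by blast
  next
    case 2
    have "\<exists>M. M \<noteq> [] \<and> distinct M \<and> set M = set Q \<union> set P \<and> walk E M \<and>
           hd M \<in> {hd Q, hd P} \<and> last M \<in> {last Q, last P}"
      by (rule main) (use 2 less.prems in auto)
    then show ?thesis by (auto simp: Un_commute)
  qed
qed

text \<open>Merging two paths lowers the count by one and keeps the cover; this is repeated until
  \<open>m\<close> paths remain.\<close>

lemma path_system_reduce:
  assumes X: "tour X E" and F: "path_system X E S R F" and "cover F = X"
    and "1 \<le> m" "m \<le> card F"
  shows "\<exists>F'. path_system X E S R F' \<and> cover F' = X \<and> card F' = m"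
  using assms(2-)
proof (induction "card F" arbitrary: F rule: less_induct)
  case less
  show ?case
  proof (cases "card F = m")
    case True
    then show ?thesis using less.prems by blast
  next
    case False
    then have "2 \<le> card F" using less.prems by simp
    then obtain P Q where PQ: "P \<in> F" "Q \<in> F" "P \<noteq> Q"
      using card_le_Suc0_iff_eq[of F] less.prems(1) unfolding path_system_def by fastforce
    then have pb: "path_between X E S R P" "path_between X E S R Q" "set P \<inter> set Q = {}"
      using less.prems(1) unfolding path_system_def by blast+
    then have "\<exists>M. M \<noteq> [] \<and> distinct M \<and> set M = set P \<union> set Q \<and> walk E M \<and>
           hd M \<in> {hd P, hd Q} \<and> last M \<in> {last P, last Q}"
      by (intro merge_paths[OF X]) (auto simp: path_between_def)
    then obtain M where M: "M \<noteq> []" "distinct M" "set M = set P \<union> set Q" "walk E M"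
           "hd M \<in> {hd P, hd Q}" "last M \<in> {last P, last Q}" by blast
    have Mb: "path_between X E S R M"
      using M pb unfolding path_between_def by auto
    have cov: "cover (F - {P, Q}) = cover F - cover {P, Q}"
      by (rule path_system_cover_Diff[OF less.prems(1)]) (use PQ in auto)
    then have disj: "set M \<inter> cover (F - {P, Q}) = {}"
      using M by auto
    have sub: "{P, Q} \<subseteq> F" using PQ by simp
    note ex = path_system_exchange[OF less.prems(1) sub Mb disj]
    have c: "card (insert M (F - {P, Q})) = card F - 1"
      using ex(2) PQ \<open>2 \<le> card F\<close> by simp
    have cv: "cover (insert M (F - {P, Q})) = X"
      using cov M less.prems(2) PQ by auto
    show ?thesis
      by (rule less.hyps[OF _ ex(1) cv less.prems(3)]) (use c False less.prems in auto)
  qed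
qed

section \<open>Reachability, and vertices that cannot be inserted into a path\<close>

text \<open>Uses duplicate-free paths, so that every member comes with a segment ready for insertion
  into a path.\<close>

definition reach :: "'a set \<Rightarrow> ('a \<times> 'a) set \<Rightarrow> 'a \<Rightarrow> 'a set" where
  "reach W E x = {y. \<exists>L. path_between W E {x} {y} L}"

lemma reach_subset: "reach W E x \<subseteq> W"
proof
  fix y assume "y \<in> reach W E x"
  then obtain L where "L \<noteq> []" "set L \<subseteq> W" "last L = y"
    unfolding reach_def path_between_def by blast
  then show "y \<in> W" using last_in_set by blast
qed

lemma reach_refl: "x \<in> W \<Longrightarrow> x \<in> reach W E x"
  unfolding reach_def path_between_def by (simp add: exI[of _ "[x]"])

lemma reach_step:
  assumes "z \<in> reach W E x" "(z, y) \<in> E" "y \<in> W"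
  shows "y \<in> reach W E x"
proof -
  obtain L where L: "path_between W E {x} {z} L" using assms(1) unfolding reach_def by blast
  show ?thesis
  proof (cases "y \<in> set L")
    case True
    then obtain L1 L2 where "L = L1 @ y # L2" by (meson split_list)
    then have L': "path_between W E {x} {z} (L1 @ y # L2)" using L by simp
    moreover have "hd (L1 @ [y]) = hd (L1 @ y # L2)" by (cases L1) simp_all
    ultimately have "hd (L1 @ [y]) = x" unfolding path_between_def by simp
    then have "path_between W E {x} {y} (L1 @ [y])"
      using L' unfolding path_between_def
      by (simp add: successively_append_iff del: hd_append2)
    then show ?thesis unfolding reach_def by blast
  next
    case False
    then have "path_between W E {x} {y} (L @ [y])"
      using L assms unfolding path_between_def by (simp add: successively_append_iff)
    then show ?thesis unfolding reach_def by blast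
  qed
qed

text \<open>The first vertex of \<open>P\<close> that does not dominate \<open>w\<close> is not
  \<open>hd P\<close>; its predecessor dominates \<open>w\<close>, so \<open>w\<close> would fit
  between the two.\<close>

lemma all_dominate_if_not_insertable:
  assumes "\<And>p. p \<in> set P \<Longrightarrow> (w, p) \<in> E \<or> (p, w) \<in> E"
    and "\<And>P1 P2. P = P1 @ P2 \<Longrightarrow> P1 \<noteq> [] \<Longrightarrow> P2 \<noteq> [] \<Longrightarrow>
           \<not> ((last P1, w) \<in> E \<and> (w, hd P2) \<in> E)"
    and "(hd P, w) \<in> E" "q \<in> set P"
  shows "(q, w) \<in> E"
proof (rule ccontr)
  assume "(q, w) \<notin> E"
  then obtain ys p zs where P: "P = ys @ p # zs" "(p, w) \<notin> E" "\<forall>y\<in>set ys. (y, w) \<in> E"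
    using split_list_first_prop[of P "\<lambda>p. (p, w) \<notin> E"] assms(4) by auto
  then have "ys \<noteq> []" using assms(3) by auto
  with P assms(1)[of p] assms(2)[of ys "p # zs"] show False by auto
qed

text \<open>The preceding lemma applies to the part of \<open>P\<close> that starts at
  \<open>p\<close>.\<close>

lemma last_dominates_if_not_insertable:
  assumes "\<And>p. p \<in> set P \<Longrightarrow> (w, p) \<in> E \<or> (p, w) \<in> E"
    and "\<And>P1 P2. P = P1 @ P2 \<Longrightarrow> P1 \<noteq> [] \<Longrightarrow> P2 \<noteq> [] \<Longrightarrow>
           \<not> ((last P1, w) \<in> E \<and> (w, hd P2) \<in> E)"
    and "(p, w) \<in> E" "p \<in> set P"
  shows "(last P, w) \<in> E"
proof -
  obtain ys zs where P: "P = ys @ p # zs" using assms(4) by (meson split_list)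
  have "(last (p # zs), w) \<in> E"
  proof (rule all_dominate_if_not_insertable)
    fix P1 P2 assume "p # zs = P1 @ P2" "P1 \<noteq> []" "P2 \<noteq> []"
    then show "\<not> ((last P1, w) \<in> E \<and> (w, hd P2) \<in> E)"
      using assms(2)[of "ys @ P1" P2] P by auto
  qed (use assms P in auto)
  then show ?thesis using P by simp
qed

lemma walk_append3:
  assumes "walk E P" "walk E L" "walk E Q" "P \<noteq> []" "L \<noteq> []" "Q \<noteq> []"
    "(last P, hd L) \<in> E" "(last L, hd Q) \<in> E"
  shows "walk E (P @ L @ Q)"
  using assms by (simp add: successively_append_iff)

text \<open>Take a longest path \<open>L\<close> from \<open>A\<close> to \<open>B\<close>. Missed
  vertices of \<open>A\<close> are dominated by all of \<open>L\<close>, missed vertices of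
  \<open>B\<close> dominate all of \<open>L\<close>, none is of both kinds, and no arc leads from
  the first kind to the second. So no arc enters the missed part of \<open>B\<close>; if nonempty,
  it would meet \<open>A\<close>. Then no arc leaves the missed part of \<open>A\<close>; if
  nonempty, it would meet \<open>B\<close>.\<close>

lemma hamiltonian_path_between:
  assumes W: "tour W E" "W \<noteq> {}" and AB: "A \<union> B = W"
    and absA: "absorbing W (E\<inverse>) A" and absB: "absorbing W E B"
  shows "\<exists>L. path_between W E A B L \<and> set L = W"
proof -
  have fin: "finite W" by (rule tour_finite[OF W(1)])
  have "W \<inter> A \<noteq> {}" using absA W(2) by (auto simp: absorbing_def)
  then obtain a where a: "a \<in> W" "a \<in> A" by blast
  \<comment> \<open>No arc of \<open>W\<close> leaves the set reachable from \<open>a\<close>, so it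
    meets \<open>B\<close>, and some path from \<open>A\<close> to \<open>B\<close> exists.\<close>
  have "reach W E a \<inter> B \<noteq> {}"
  proof (rule absorbingD[OF absB reach_subset])
    show "reach W E a \<noteq> {}" using reach_refl[OF a(1)] by blast
  next
    fix z y assume "z \<in> reach W E a" "y \<in> W - reach W E a"
    then show "(z, y) \<notin> E" using reach_step[of z W E a y] by auto
  qed
  then obtain b L0 where "b \<in> B" "path_between W E {a} {b} L0" by (auto simp: reach_def)
  then have "path_between W E A B L0" using a by (simp add: path_between_def)
  moreover have "length L \<le> card W" if "path_between W E A B L" for L
    using that fin unfolding path_between_def by (metis card_mono distinct_card)
  \<comment> \<open>The bound in \<open>ex_has_greatest_nat\<close> is strict, hence
    \<open>Suc (card W)\<close>.\<close>
  ultimately obtain L where L: "path_between W E A B L"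
    and max: "\<And>L'. path_between W E A B L' \<Longrightarrow> length L' \<le> length L"
    using ex_has_greatest_nat[of "path_between W E A B" L0 length "Suc (card W)"] by (auto simp: less_Suc_eq_le)
  note Ld = path_betweenD[OF L]
  have adj: "(w, p) \<in> E \<or> (p, w) \<in> E" if "w \<in> W - set L" "p \<in> set L" for w p
    using tour_arc_iff[OF W(1), of w p] that Ld(3) by blast
  have noins: "\<not> ((last P1, w) \<in> E \<and> (w, hd P2) \<in> E)"
    if w: "w \<in> W - set L" and P: "L = P1 @ P2" "P1 \<noteq> []" "P2 \<noteq> []" for w P1 P2
  proof
    assume *: "(last P1, w) \<in> E \<and> (w, hd P2) \<in> E"
    have "walk E (P1 @ [w] @ P2)"
      by (rule walk_append3) (use * P Ld(4) in \<open>auto simp: successively_append_iff\<close>)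
    then have "path_between W E A B (P1 @ [w] @ P2)"
      using L P w unfolding path_between_def by simp
    then show False using max[of "P1 @ [w] @ P2"] P by simp
  qed
  have noA: "\<not> (w, hd L) \<in> E" if w: "w \<in> W - set L" "w \<in> A" for w
  proof
    assume "(w, hd L) \<in> E"
    then have "path_between W E A B (w # L)"
      using L w unfolding path_between_def by (simp add: successively_Cons)
    then show False using max[of "w # L"] by simp
  qed
  have noB: "\<not> (last L, w) \<in> E" if w: "w \<in> W - set L" "w \<in> B" for w
  proof
    assume "(last L, w) \<in> E"
    then have "path_between W E A B (L @ [w])"
      using L w unfolding path_between_def by (simp add: successively_append_iff)
    then show False using max[of "L @ [w]"] by simp
  qed
  have domA: "(p, w) \<in> E" if "w \<in> W - set L" "w \<in> A" "p \<in> set L" for w p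
  proof (rule all_dominate_if_not_insertable[of L w E])
    show "(hd L, w) \<in> E" using noA[OF that(1,2)] adj[OF that(1) hd_in_set[OF Ld(1)]] by blast
  qed (use that adj noins in blast)+
  have notboth: False if "w \<in> W - set L" "w \<in> A" "w \<in> B" for w
    using domA[OF that(1,2) last_in_set[OF Ld(1)]] noB[OF that(1,3)] by blast
  define K1 where "K1 = (W - set L) \<inter> A"
  define K2 where "K2 = (W - set L) \<inter> B"
  have part: "W = set L \<union> K1 \<union> K2" "K1 \<inter> K2 = {}"
    using AB Ld(3) notboth by (auto simp: K1_def K2_def)
  have domB: "(w, p) \<in> E" if w: "w \<in> K2" and p: "p \<in> set L" for w p
  proof (rule ccontr)
    assume "(w, p) \<notin> E"
    then have "(p, w) \<in> E" using adj[of w p] w p by (auto simp: K2_def)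
    then have "(last L, w) \<in> E"
      by (intro last_dominates_if_not_insertable[of L w E p])
        (use w p adj noins in \<open>auto simp: K2_def\<close>)
    then show False using noB w by (auto simp: K2_def)
  qed
  have K: "(k1, k2) \<notin> E" if k: "k1 \<in> K1" "k2 \<in> K2" for k1 k2
  proof
    assume e: "(k1, k2) \<in> E"
    have "walk E (k1 # k2 # L)"
      using e domB[OF k(2) hd_in_set[OF Ld(1)]] Ld by (simp add: successively_Cons)
    moreover have "k1 \<noteq> k2" using k part by blast
    ultimately have "path_between W E A B (k1 # k2 # L)"
      using L k unfolding path_between_def by (auto simp: K1_def K2_def)
    then show False using max[of "k1 # k2 # L"] by simp
  qed
  have "K2 = {}"
  proof (rule ccontr)
    assume ne: "K2 \<noteq> {}"
    have "(y, z) \<notin> E" if "z \<in> K2" "y \<in> W - K2" for y z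
    proof (cases "y \<in> K1")
      case True
      then show ?thesis using K that by blast
    next
      case False
      then have "(z, y) \<in> E" using domB that part by blast
      then show ?thesis using tour_arc_iff[OF W(1), of z y] that by (auto simp: K2_def)
    qed
    then have "K2 \<inter> A \<noteq> {}"
      by (intro absorbingD[OF absA]) (use ne in \<open>auto simp: K2_def\<close>)
    then show False using notboth by (auto simp: K2_def)
  qed
  moreover have "K1 = {}"
  proof (rule ccontr)
    assume ne: "K1 \<noteq> {}"
    have "(z, y) \<notin> E" if "z \<in> K1" "y \<in> W - K1" for y z
    proof -
      have z: "z \<in> W - set L" "z \<in> A" and y: "y \<in> W"
        using that by (simp_all add: K1_def)
      have "y \<in> set L" using that part(1) \<open>K2 = {}\<close> by blast
      then have "(y, z) \<in> E" "y \<noteq> z" using domA[OF z] z by blast+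
      then show ?thesis using tour_arc_iff[OF W(1), of y z] z y by blast
    qed
    then have "K1 \<inter> B \<noteq> {}"
      by (intro absorbingD[OF absB]) (use ne in \<open>auto simp: K1_def\<close>)
    then show False using notboth by (auto simp: K1_def)
  qed
  ultimately have "set L = W" using part by blast
  then show ?thesis using L by blast
qed

section \<open>Path systems with inclusion-maximal cover\<close>

text \<open>Stated relative to \<open>card F\<close> itself, so that no fixed lower bound on the
  number of paths has to be carried along.\<close>

definition cover_maximal ::
  "'a set \<Rightarrow> ('a \<times> 'a) set \<Rightarrow> 'a set \<Rightarrow> 'a set \<Rightarrow> 'a list set \<Rightarrow> bool" where
  "cover_maximal X E S R F \<longleftrightarrow> path_system X E S R F \<and>
     (\<forall>F'. path_system X E S R F' \<longrightarrow> card F \<le> card F' \<longrightarrow> \<not> cover F \<subset> cover F')"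

lemma cover_maximal_rev:
  assumes "cover_maximal X E S R F"
  shows "cover_maximal X (E\<inverse>) R S (rev ` F)"
  unfolding cover_maximal_def
proof (intro conjI allI impI)
  show "path_system X (E\<inverse>) R S (rev ` F)"
    using assms by (simp add: cover_maximal_def path_system_rev)
next
  fix F' assume "path_system X (E\<inverse>) R S F'" "card (rev ` F) \<le> card F'"
  then have "path_system X E S R (rev ` F')" "card F \<le> card (rev ` F')"
    using path_system_rev[of X "E\<inverse>" R S F'] by simp_all
  then have "\<not> cover F \<subset> cover (rev ` F')"
    using assms unfolding cover_maximal_def by blast
  then show "\<not> cover (rev ` F) \<subset> cover F'" by simp
qed

lemma cover_maximal_no_replacement:
  assumes F: "cover_maximal X E S R F" and P: "P \<in> F" "set P \<subset> set Q"
    and Q: "path_between X E S R Q" "set Q \<inter> cover F \<subseteq> set P"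
  shows False
proof -
  have ps: "path_system X E S R F" using F by (simp add: cover_maximal_def)
  have G: "{P} \<subseteq> F" using P by simp
  have cov: "cover (F - {P}) = cover F - set P"
    using path_system_cover_Diff[OF ps G] by simp
  have disj: "set Q \<inter> cover (F - {P}) = {}" unfolding cov using Q(2) by blast
  note ex = path_system_exchange[OF ps G Q(1) disj]
  have "cover (insert Q (F - {P})) = set Q \<union> (cover F - set P)" using cov by simp
  then have "cover F \<subset> cover (insert Q (F - {P}))"
    using P Q(2) by blast
  moreover have "card F \<le> card (insert Q (F - {P}))" using ex(2) P by simp
  ultimately show False using F ex(1) unfolding cover_maximal_def by blast
qed

lemma cover_maximal_no_new_path:
  assumes F: "cover_maximal X E S R F"
    and Q: "path_between X E S R Q" "set Q \<inter> cover F = {}"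
  shows False
proof -
  have ps: "path_system X E S R F" using F by (simp add: cover_maximal_def)
  have disj: "set Q \<inter> cover (F - {}) = {}" using Q(2) by simp
  note ex = path_system_exchange[OF ps empty_subsetI Q(1) disj]
  have "cover F \<subset> cover (insert Q (F - {}))"
    using Q(2) path_betweenD(1)[OF Q(1)] by (cases Q) auto
  moreover have "card F \<le> card (insert Q (F - {}))" using ex(2) by simp
  ultimately show False using F ex(1) unfolding cover_maximal_def by blast
qed

lemma cover_maximal_no_insertion:
  assumes F: "cover_maximal X E S R F" and P: "P1 @ P2 \<in> F" "P1 \<noteq> []" "P2 \<noteq> []"
    and L: "L \<noteq> []" "distinct L" "set L \<subseteq> X - cover F" "walk E L"
    and arcs: "(last P1, hd L) \<in> E" "(last L, hd P2) \<in> E"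
  shows False
proof -
  have "path_between X E S R (P1 @ P2)"
    using F P path_systemD(2) by (auto simp: cover_maximal_def)
  note d = path_betweenD[OF this]
  have w: "walk E (P1 @ L @ P2)"
    by (rule walk_append3) (use d P L arcs in \<open>auto simp: successively_append_iff\<close>)
  have LP: "set L \<inter> set (P1 @ P2) = {}" using L(3) P(1) by blast
  have "path_between X E S R (P1 @ L @ P2)"
    unfolding path_between_def using w d P L LP by auto
  moreover have "set (P1 @ P2) \<subset> set (P1 @ L @ P2)"
    using L(1) LP by (cases L) auto
  moreover have "set (P1 @ L @ P2) \<inter> cover F \<subseteq> set (P1 @ P2)" using L(3) by auto
  ultimately show False using cover_maximal_no_replacement[OF F P(1)] by blast
qed

lemma cover_maximal_no_prefix:
  assumes F: "cover_maximal X E S R F" and P: "P \<in> F"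
    and L: "L \<noteq> []" "distinct L" "set L \<subseteq> X - cover F" "walk E L"
    and "hd L \<in> S" "(last L, hd P) \<in> E"
  shows False
proof -
  have "path_between X E S R P"
    using F P path_systemD(2) by (auto simp: cover_maximal_def)
  note d = path_betweenD[OF this]
  have LP: "set L \<inter> set P = {}" using L(3) P by blast
  have "path_between X E S R (L @ P)"
    unfolding path_between_def using assms d LP by (auto simp: successively_append_iff)
  moreover have "set P \<subset> set (L @ P)"
    using L(1) LP by (cases L) auto
  moreover have "set (L @ P) \<inter> cover F \<subseteq> set P" using L(3) by auto
  ultimately show False using cover_maximal_no_replacement[OF F P] by blast
qed

text \<open>An uncovered \<open>x\<close> in \<open>S\<close> fits neither before nor into a path,
  so all covered vertices dominate it. An arc from a vertex reached from \<open>x\<close> to a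
  covered \<open>y\<close> would let a whole segment be inserted right before \<open>y\<close>. So
  no arc leaves the reached set; it meets \<open>R\<close> and yields a new path.\<close>

lemma cover_maximal_uncovered_not_start:
  assumes X: "tour X E" and F: "cover_maximal X E S R F" and abs: "absorbing X E R"
    and x: "x \<in> X - cover F"
  shows "x \<notin> S"
proof
  assume "x \<in> S"
  let ?W = "X - cover F"
  let ?Z = "reach ?W E x"
  have ps: "path_system X E S R F" using F by (simp add: cover_maximal_def)
  have seg: "\<exists>L. L \<noteq> [] \<and> distinct L \<and> set L \<subseteq> X - cover F \<and> walk E L \<and> hd L = x \<and> last L = z"
    if "z \<in> ?Z" for z
    using that unfolding reach_def path_between_def by blast
  have adj: "(x, p) \<in> E \<or> (p, x) \<in> E" if "P \<in> F" "p \<in> set P" for P p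
  proof -
    have "p \<in> X" using path_betweenD(3)[OF path_systemD(2)[OF ps that(1)]] that by blast
    moreover have "p \<noteq> x" using x that by blast
    ultimately show ?thesis using tour_arc_iff[OF X, of x p] x by blast
  qed
  have dom: "(p, x) \<in> E" if P: "P \<in> F" "p \<in> set P" for P p
  proof (rule all_dominate_if_not_insertable[of P x E])
    have ne: "P \<noteq> []" using P by auto
    have "(x, hd P) \<notin> E"
      using cover_maximal_no_prefix[OF F P(1), of "[x]"] x \<open>x \<in> S\<close> by auto
    then show "(hd P, x) \<in> E" using adj[OF P(1) hd_in_set[OF ne]] by blast
  next
    fix P1 P2 assume "P = P1 @ P2" "P1 \<noteq> []" "P2 \<noteq> []"
    then show "\<not> ((last P1, x) \<in> E \<and> (x, hd P2) \<in> E)"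
      using cover_maximal_no_insertion[OF F, of P1 P2 "[x]"] x P by auto
  qed (use P adj in blast)+
  have "(z, y) \<notin> E" if z: "z \<in> ?Z" and y: "y \<in> X - ?Z" for z y
  proof
    assume e: "(z, y) \<in> E"
    obtain L where L: "L \<noteq> []" "distinct L" "set L \<subseteq> ?W" "walk E L" "hd L = x" "last L = z"
      using seg[OF z] by blast
    have "y \<in> cover F" using reach_step[OF z e] y by blast
    then obtain P where P: "P \<in> F" "y \<in> set P" by blast
    then obtain P1 P2 where P': "P = P1 @ y # P2" by (meson split_list)
    show False
    proof (cases "P1 = []")
      case True
      then show False
        using cover_maximal_no_prefix[OF F P(1) L(1-4)] L(5,6) \<open>x \<in> S\<close> e P' by simp
    next
      case False
      have "(last P1, x) \<in> E" by (rule dom[OF P(1)]) (use False P' in simp)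
      then show False
        using cover_maximal_no_insertion[OF F, of P1 "y # P2" L] L False e P' P(1) by simp
    qed
  qed
  moreover have "?Z \<subseteq> X" using reach_subset[of ?W E x] by blast
  moreover have "?Z \<noteq> {}" using reach_refl[OF x] by blast
  ultimately have "?Z \<inter> R \<noteq> {}" by (intro absorbingD[OF abs])
  then obtain z where z: "z \<in> ?Z" "z \<in> R" by blast
  then obtain L where "path_between ?W E {x} {z} L" by (auto simp: reach_def)
  then have "path_between X E S R L" "set L \<inter> cover F = {}"
    using \<open>x \<in> S\<close> z unfolding path_between_def by auto
  then show False by (rule cover_maximal_no_new_path[OF F])
qed

subsection \<open>Spanning path systems\<close>

lemma spanning_path_system:
  assumes X: "tour X E" and absR: "absorbing X E R" and absS: "absorbing X (E\<inverse>) S"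
    and F0: "path_system X E S R F0" "m + 2 \<le> card F0" and m: "1 \<le> m"
  shows "\<exists>F. path_system X E S R F \<and> cover F = X \<and> card F = m"
proof -
  have finX: "finite X" by (rule tour_finite[OF X])
  have bound: "card (cover F) \<le> card X" if "path_system X E S R F" for F
    using card_mono[OF finX path_system_cover_subset[OF that]] .
  obtain F where F: "path_system X E S R F" "m + 2 \<le> card F"
    and maxF: "\<And>F'. path_system X E S R F' \<Longrightarrow> m + 2 \<le> card F' \<Longrightarrow>
                 card (cover F') \<le> card (cover F)"
    using ex_has_greatest_nat[of "\<lambda>F. path_system X E S R F \<and> m + 2 \<le> card F" F0
        "\<lambda>F. card (cover F)" "Suc (card X)"] F0 bound by (auto simp: less_Suc_eq_le)
  \<comment> \<open>A strictly larger cover would have more elements, so maximal cardinality is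
    enough.\<close>
  have cm: "cover_maximal X E S R F"
    unfolding cover_maximal_def
  proof (intro conjI allI impI notI)
    fix F' assume F': "path_system X E S R F'" "card F \<le> card F'" "cover F \<subset> cover F'"
    have "finite (cover F')" using path_system_cover_subset[OF F'(1)] finX finite_subset by blast
    then have "card (cover F) < card (cover F')" using F'(3) by (rule psubset_card_mono)
    then show False using maxF[OF F'(1)] F(2) F'(2) by linarith
  qed (rule F(1))
  let ?W = "X - cover F"
  have pb: "path_between X E S R P" if "P \<in> F" for P
    using path_systemD(2)[OF F(1) that] .
  \<comment> \<open>Replacing at most three paths by one loses at most two, so at least
    \<open>m\<close> are left, and merging brings the number down to \<open>m\<close>.\<close>
  have finish: ?thesis
    if G: "G \<subseteq> F" "card G \<le> 3" and M: "path_between X E S R M" "set M = cover G \<union> ?W" for G M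
  proof -
    have cov: "cover (F - G) = cover F - cover G" by (rule path_system_cover_Diff[OF F(1) G(1)])
    have disj: "set M \<inter> cover (F - G) = {}" unfolding cov M(2) by blast
    note ex = path_system_exchange[OF F(1) G(1) M(1) disj]
    have "cover G \<subseteq> cover F" using G(1) by blast
    then have "set M \<union> (cover F - cover G) = X"
      using path_system_cover_subset[OF F(1)] unfolding M(2) by blast
    then have "cover (insert M (F - G)) = X" using cov by simp
    moreover have "m \<le> card (insert M (F - G))" using ex(2) G(2) F(2) by simp
    ultimately show ?thesis using path_system_reduce[OF X ex(1)] m by blast
  qed
  show ?thesis
  proof (cases "?W = {}")
    case True
    then have "cover F = X" using path_system_cover_subset[OF F(1)] by blast
    then show ?thesis using path_system_reduce[OF X F(1) _ m] F(2) by simp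
  next
    case False
    have noS: "x \<notin> S" if "x \<in> ?W" for x
      by (rule cover_maximal_uncovered_not_start[OF X cm absR that])
    have noR: "x \<notin> R" if "x \<in> ?W" for x
      by (rule cover_maximal_uncovered_not_start[OF tour_converse[OF X] cover_maximal_rev[OF cm] absS])
        (use that in simp)
    have adj: "(w, p) \<in> E \<or> (p, w) \<in> E" if "w \<in> ?W" "P \<in> F" "p \<in> set P" for w P p
    proof -
      have "p \<in> X" using path_betweenD(3)[OF pb[OF that(2)]] that(3) by blast
      moreover have "p \<noteq> w" using that by blast
      ultimately show ?thesis using tour_arc_iff[OF X, of w p] that(1) by blast
    qed
    have asym: "(p, w) \<notin> E" if "w \<in> ?W" "P \<in> F" "p \<in> set P" "(w, p) \<in> E" for w P p
    proof -
      have "p \<in> X" using path_betweenD(3)[OF pb[OF that(2)]] that(3) by blast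
      moreover have "p \<noteq> w" using that by blast
      ultimately show ?thesis using tour_arc_iff[OF X, of w p] that(1,4) by blast
    qed
    have noins: "\<not> ((last P1, w) \<in> E \<and> (w, hd P2) \<in> E)"
      if "w \<in> ?W" "P \<in> F" "P = P1 @ P2" "P1 \<noteq> []" "P2 \<noteq> []" for w P P1 P2
      using cover_maximal_no_insertion[OF cm, of P1 P2 "[w]"] that by auto
    have dom_hd: "(q, w) \<in> E" if "w \<in> ?W" "P \<in> F" "(hd P, w) \<in> E" "q \<in> set P" for w P q
      by (rule all_dominate_if_not_insertable[OF adj[OF that(1,2)] noins[OF that(1,2)] that(3,4)])
    have dom_last: "(last P, w) \<in> E" if "w \<in> ?W" "P \<in> F" "(p, w) \<in> E" "p \<in> set P" for w P p
      by (rule last_dominates_if_not_insertable[OF adj[OF that(1,2)] noins[OF that(1,2)] that(3,4)])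
    have to_hd: "(w, hd P) \<in> E" if "w \<in> ?W" "P \<in> F" "(w, q) \<in> E" "q \<in> set P" for w P q
      using asym[OF that(1,2,4,3)] dom_hd[OF that(1,2) _ that(4)]
        adj[OF that(1,2) hd_in_set[OF path_betweenD(1)[OF pb[OF that(2)]]]] by blast
    \<comment> \<open>If \<open>w\<close> does not dominate \<open>hd P\<close>, all of
      \<open>P\<close> dominates \<open>w\<close>.\<close>
    have hd_or_last: "(w, hd P) \<in> E \<or> (last P, w) \<in> E" if "w \<in> ?W" "P \<in> F" for w P
      using dom_hd[OF that _ last_in_set[OF path_betweenD(1)[OF pb[OF that(2)]]]]
        adj[OF that hd_in_set[OF path_betweenD(1)[OF pb[OF that(2)]]]] by blast
    \<comment> \<open>\<open>A\<close> is where \<open>?W\<close> can be entered from the end of a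
      path, \<open>B\<close> where it can be left to the start of one.\<close>
    define A where "A = {w \<in> ?W. \<exists>P\<in>F. (last P, w) \<in> E}"
    define B where "B = {w \<in> ?W. \<exists>P\<in>F. (w, hd P) \<in> E}"
    have "F \<noteq> {}" using F(2) by auto
    then obtain P0 where "P0 \<in> F" by blast
    then have AB: "A \<union> B = ?W" using hd_or_last unfolding A_def B_def by blast
    \<comment> \<open>By \<open>dom_last\<close>, no covered vertex dominates a vertex outside
      \<open>A\<close>. So a set in \<open>?W\<close> that misses \<open>A\<close> and is not
      entered from within \<open>?W\<close> is not entered at all; \<open>absS\<close> makes it meet
      \<open>S\<close>, against \<open>noS\<close>. The proof of \<open>absB\<close> is the mirror
      image, with \<open>to_hd\<close>.\<close>
    have absA: "absorbing ?W (E\<inverse>) A"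
      unfolding absorbing_def
    proof (intro allI impI notI)
      fix Z assume Z: "Z \<subseteq> ?W" "Z \<noteq> {}" "\<forall>z\<in>Z. \<forall>y\<in>?W - Z. (z, y) \<notin> E\<inverse>" "Z \<inter> A = {}"
      have "(z, y) \<notin> E\<inverse>" if z: "z \<in> Z" and y: "y \<in> X - Z" for z y
      proof (cases "y \<in> cover F")
        case True
        then obtain P where P: "P \<in> F" "y \<in> set P" by blast
        have zW: "z \<in> ?W" using z Z(1) by blast
        have "z \<notin> A" using z Z(4) by blast
        then have "(y, z) \<notin> E" using dom_last[OF zW P(1) _ P(2)] P(1) zW by (auto simp: A_def)
        then show ?thesis by simp
      next
        case False
        then show ?thesis using Z(3) z y by blast
      qed
      then have "Z \<inter> S \<noteq> {}" using absorbingD[OF absS _ Z(2)] Z(1) by blast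
      then show False using noS Z(1) by blast
    qed
    have absB: "absorbing ?W E B"
      unfolding absorbing_def
    proof (intro allI impI notI)
      fix Z assume Z: "Z \<subseteq> ?W" "Z \<noteq> {}" "\<forall>z\<in>Z. \<forall>y\<in>?W - Z. (z, y) \<notin> E" "Z \<inter> B = {}"
      have "(z, y) \<notin> E" if z: "z \<in> Z" and y: "y \<in> X - Z" for z y
      proof (cases "y \<in> cover F")
        case True
        then obtain P where P: "P \<in> F" "y \<in> set P" by blast
        have zW: "z \<in> ?W" using z Z(1) by blast
        have "z \<notin> B" using z Z(4) by blast
        then show ?thesis using to_hd[OF zW P(1) _ P(2)] P(1) zW by (auto simp: B_def)
      next
        case False
        then show ?thesis using Z(3) z y by blast
      qed
      then have "Z \<inter> R \<noteq> {}" using absorbingD[OF absR _ Z(2)] Z(1) by blast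
      then show False using noR Z(1) by blast
    qed
    have "tour ?W E" by (rule tour_subset[OF X]) blast
    from hamiltonian_path_between[OF this False AB absA absB]
    obtain L where L: "path_between ?W E A B L" and setL: "set L = ?W" by blast
    note Ld = path_betweenD[OF L]
    have hdL: "hd L \<in> ?W" and lastL: "last L \<in> ?W"
      using setL hd_in_set[OF Ld(1)] last_in_set[OF Ld(1)] by simp_all
    obtain P where P: "P \<in> F" "(last P, hd L) \<in> E" using Ld(5) by (auto simp: A_def)
    have disjL: "set P \<inter> set L = {}" if "P \<in> F" for P
      unfolding setL using that by blast
    have two: ?thesis
      if PQ: "P \<in> F" "Q \<in> F" "P \<noteq> Q" "(last P, hd L) \<in> E" "(last L, hd Q) \<in> E" for P Q
    proof (rule finish)
      note d = path_betweenD[OF pb[OF PQ(1)]] path_betweenD[OF pb[OF PQ(2)]]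
      show "{P, Q} \<subseteq> F" "card {P, Q} \<le> 3" using PQ by (auto simp: card_insert_if)
      show "set (P @ L @ Q) = cover {P, Q} \<union> ?W" using setL by auto
      have "walk E (P @ L @ Q)" by (rule walk_append3) (use d Ld PQ in simp_all)
      moreover have "distinct (P @ L @ Q)"
        using d Ld path_systemD(3)[OF F(1) PQ(1-3)] disjL[OF PQ(1)] disjL[OF PQ(2)]
        by (simp add: Int_Un_distrib Int_commute)
      moreover have "set (P @ L @ Q) \<subseteq> X" using d(3,9) setL by auto
      ultimately show "path_between X E S R (P @ L @ Q)"
        unfolding path_between_def using d by simp
    qed
    show ?thesis
    proof (cases "\<exists>Q\<in>F. Q \<noteq> P \<and> ((last Q, hd L) \<in> E \<or> (last L, hd Q) \<in> E)")
      case True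
      then obtain Q where Q: "Q \<in> F" "Q \<noteq> P" "(last Q, hd L) \<in> E \<or> (last L, hd Q) \<in> E" by blast
      \<comment> \<open>If \<open>last Q\<close> dominates \<open>hd L\<close>, join
        \<open>Q\<close> to \<open>Q'\<close> when they differ, and otherwise \<open>P\<close> to
        \<open>Q'\<close>.\<close>
      obtain Q' where Q': "Q' \<in> F" "(last L, hd Q') \<in> E" using Ld(6) by (auto simp: B_def)
      show ?thesis
        using two[of P Q] two[of Q Q'] two[of P Q'] P Q Q' by blast
    next
      case False
      then have others: "(last Q, hd L) \<notin> E" "(last L, hd Q) \<notin> E" if "Q \<in> F" "Q \<noteq> P" for Q
        using that by blast+
      then have PL: "(last L, hd P) \<in> E" using Ld(6) by (auto simp: B_def)
      \<comment> \<open>\<open>card F \<ge> m + 2 \<ge> 3\<close> leaves two paths besides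
        \<open>P\<close>.\<close>
      have "\<not> card (F - {P}) \<le> Suc 0" using F m P(1) path_systemD(1)[OF F(1)] by simp
      then obtain P' P'' where P': "P' \<in> F" "P' \<noteq> P" and P'': "P'' \<in> F" "P'' \<noteq> P" "P' \<noteq> P''"
        using card_le_Suc0_iff_eq[of "F - {P}"] path_systemD(1)[OF F(1)] by auto
      have "(hd L, hd P') \<in> E" using hd_or_last[OF hdL P'(1)] others(1)[OF P'] by blast
      then have "\<exists>x\<in>set L. (x, hd P') \<in> E \<or> (x, hd P'') \<in> E" using hd_in_set[OF Ld(1)] by blast
      \<comment> \<open>Both ends of \<open>L\<close> attach to \<open>P\<close> only, so \<open>L\<close> is cut into \<open>L1 @ [x]\<close> and \<open>L2\<close>, and with
        two further paths \<open>A\<close>, \<open>B\<close> the pieces are traversed in the order \<open>B\<close>, \<open>L2\<close>, \<open>P\<close>, \<open>L1 @ [x]\<close>, \<open>A\<close>.\<close>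
      from split_list_last_prop[OF this] obtain L1 x L2
        where L12: "L = L1 @ x # L2" "(x, hd P') \<in> E \<or> (x, hd P'') \<in> E"
          "\<forall>y\<in>set L2. \<not> ((y, hd P') \<in> E \<or> (y, hd P'') \<in> E)" by blast
      \<comment> \<open>\<open>last L\<close> dominates neither \<open>hd P'\<close> nor
        \<open>hd P''\<close>, so it is not \<open>x\<close>.\<close>
      have L2: "L2 \<noteq> []"
        using L12 others(2)[OF P'] others(2)[OF P''(1,2)] by auto
      \<comment> \<open>These \<open>A\<close> and \<open>B\<close> are paths and shadow the vertex
        sets above. The last assumption yields an arc from \<open>last B\<close> to
        \<open>hd L2\<close>.\<close>
      have three: ?thesis
        if AB: "A \<in> F" "A \<noteq> P" "B \<in> F" "B \<noteq> P" "A \<noteq> B" "(x, hd A) \<in> E" "(hd L2, hd B) \<notin> E"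
        for A B
      proof (rule finish)
        note d = path_betweenD[OF pb[OF AB(1)]] path_betweenD[OF pb[OF AB(3)]]
          path_betweenD[OF pb[OF P(1)]]
        have "hd L2 \<in> ?W" using setL L2 L12(1) hd_in_set[OF L2] by auto
        then have BL: "(last B, hd L2) \<in> E" using hd_or_last[OF _ AB(3)] AB(7) by blast
        let ?M = "B @ L2 @ P @ (L1 @ [x]) @ A"
        have hdL': "hd (L1 @ [x]) = hd L" using L12(1) by (cases L1) simp_all
        have "card {A, B, P} \<le> 3" by (simp add: card_insert_if)
        then show "{A, B, P} \<subseteq> F" "card {A, B, P} \<le> 3" using AB P by auto
        show "set ?M = cover {A, B, P} \<union> ?W" unfolding setL[symmetric] L12(1) by auto
        have "walk E (P @ (L1 @ [x]) @ A)"
        proof (rule walk_append3)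
          show "walk E (L1 @ [x])" using Ld(4) L12(1) by (simp add: successively_append_iff)
          show "(last P, hd (L1 @ [x])) \<in> E" unfolding hdL' by (rule P(2))
        qed (use d AB in simp_all)
        moreover have "walk E (B @ L2 @ P)"
        proof (rule walk_append3)
          show "walk E L2"
            using Ld(4) L12(1) L2 by (simp add: successively_append_iff successively_Cons)
          show "(last L2, hd P) \<in> E" using PL L12(1) L2 by simp
        qed (use d BL L2 in simp_all)
        moreover have "?M = (B @ L2) @ P @ (L1 @ [x]) @ A" by simp
        moreover have "hd (P @ (L1 @ [x]) @ A) = hd P" using d(13) by simp
        ultimately have "walk E ?M"
          using d(13) L2 unfolding successively_append_iff[of _ "B @ L2"]
          by (metis append_assoc append_is_Nil_conv successively_append_iff)
        moreover have "distinct ?M"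
        proof -
          have "set A \<inter> set B = {}" "set A \<inter> set P = {}" "set B \<inter> set P = {}"
            using path_systemD(3)[OF F(1)] AB P(1) by blast+
          moreover have "set L \<inter> set A = {}" "set L \<inter> set B = {}" "set L \<inter> set P = {}"
            using disjL AB P(1) by blast+
          moreover have "distinct L" by (rule Ld(2))
          ultimately show ?thesis using d unfolding L12(1) by auto
        qed
        moreover have "set ?M \<subseteq> X"
        proof -
          have "set L \<subseteq> X" using setL by blast
          then show ?thesis using d(3,9,15) unfolding L12(1) by simp
        qed
        ultimately show "path_between X E S R ?M"
          unfolding path_between_def using d by simp
      qed
      have "(hd L2, hd P') \<notin> E" "(hd L2, hd P'') \<notin> E" using L12(3) hd_in_set[OF L2] by blast+
      then show ?thesis
        using three[of P' P''] three[of P'' P'] P' P'' L12(2) by blast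
    qed
  qed
qed

subsection \<open>Degree conditions\<close>

lemma tour_degree_sum:
  assumes "tour Z E" "z \<in> Z"
  shows "card {y \<in> Z. (z, y) \<in> E} + card {y \<in> Z. (y, z) \<in> E} + 1 = card Z"
proof -
  have fin: "finite Z" by (rule tour_finite[OF assms(1)])
  have "Z - {z} = {y \<in> Z. (z, y) \<in> E} \<union> {y \<in> Z. (y, z) \<in> E}"
    using assms unfolding tour_def by blast
  moreover have "{y \<in> Z. (z, y) \<in> E} \<inter> {y \<in> Z. (y, z) \<in> E} = {}"
    using tour_asym[OF assms] by blast
  ultimately have "card (Z - {z}) = card {y \<in> Z. (z, y) \<in> E} + card {y \<in> Z. (y, z) \<in> E}"
    using fin by (simp add: card_Un_disjoint)
  moreover have "card Z > 0" using fin assms(2) by (auto simp: card_gt_0_iff)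
  ultimately show ?thesis using fin assms(2) by simp
qed

text \<open>Otherwise every out-degree in \<open>Z\<close> would exceed the in-degree, although both
  sums count the arcs within \<open>Z\<close>.\<close>

lemma exists_low_out_degree:
  assumes Z: "tour Z E" "Z \<noteq> {}"
  shows "\<exists>z\<in>Z. 2 * card {y \<in> Z. (z, y) \<in> E} + 1 \<le> card Z"
proof (rule ccontr)
  assume neg: "\<not> ?thesis"
  have fin: "finite Z" by (rule tour_finite[OF Z(1)])
  have "card {y \<in> Z. (y, z) \<in> E} < card {y \<in> Z. (z, y) \<in> E}" if "z \<in> Z" for z
    using tour_degree_sum[OF Z(1) that] neg that by fastforce
  then have "(\<Sum>z\<in>Z. card {y \<in> Z. (y, z) \<in> E}) < (\<Sum>z\<in>Z. card {y \<in> Z. (z, y) \<in> E})"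
    using Z(2) fin by (intro sum_strict_mono) auto
  moreover have "(\<Sum>z\<in>Z. card {y \<in> Z. (y, z) \<in> E}) = (\<Sum>z\<in>Z. card {y \<in> Z. (z, y) \<in> E})"
    using fin sum.swap[of "\<lambda>z y. if (y, z) \<in> E then 1 else 0 :: nat" Z Z]
    by (simp add: sum.If_cases Int_def)
  ultimately show False by simp
qed

lemma exists_low_in_degree:
  assumes "tour Z E" "Z \<noteq> {}"
  shows "\<exists>z\<in>Z. 2 * card {y \<in> Z. (y, z) \<in> E} + 1 \<le> card Z"
  using exists_low_out_degree[OF tour_converse[OF assms(1)] assms(2)] by simp

text \<open>For a counterexample \<open>Z\<close>, no arc leads from \<open>Z\<close> to the rest
  \<open>Y\<close> of \<open>V - {u}\<close>. A vertex of low out-degree in \<open>Z\<close> gives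
  \<open>card Z \<ge> 2 * d - 1\<close>, one of low in-degree in \<open>Y\<close> gives the same for
  \<open>Y\<close>, and together with \<open>u\<close> this exceeds \<open>card V\<close>.\<close>

lemma absorbing_if_min_degree:
  assumes V: "tour V E" "u \<in> V" "v \<in> V" "u \<noteq> v"
    and out: "\<And>x. x \<in> V \<Longrightarrow> d \<le> card {y \<in> V. (x, y) \<in> E}"
    and ind: "\<And>x. x \<in> V \<Longrightarrow> d \<le> card {y \<in> V. (y, x) \<in> E}"
    and d: "card V + 1 < 4 * d"
  shows "absorbing (V - {u, v}) E {x \<in> V - {u, v}. (x, v) \<in> E}"
  unfolding absorbing_def
proof (intro allI impI notI)
  fix Z assume Z: "Z \<subseteq> V - {u, v}" "Z \<noteq> {}" "\<forall>z\<in>Z. \<forall>y\<in>V - {u, v} - Z. (z, y) \<notin> E"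
    "Z \<inter> {x \<in> V - {u, v}. (x, v) \<in> E} = {}"
  have fin: "finite V" by (rule tour_finite[OF V(1)])
  \<comment> \<open>\<open>v\<close> is counted in \<open>Y\<close>: it makes \<open>Y\<close>
    nonempty and receives no arc from \<open>Z\<close>.\<close>
  define Y where "Y = V - {u} - Z"
  have noarc: "(z, y) \<notin> E" if "z \<in> Z" "y \<in> Y" for z y
    using that Z by (cases "y = v") (auto simp: Y_def)
  have ZV: "Z \<subseteq> V" "Y \<subseteq> V" "Y \<noteq> {}" using Z(1) V by (auto simp: Y_def)
  have finZ: "finite Z" "finite Y" using ZV fin finite_subset by blast+
  obtain z where z: "z \<in> Z" "2 * card {y \<in> Z. (z, y) \<in> E} + 1 \<le> card Z"
    using exists_low_out_degree[OF tour_subset[OF V(1) ZV(1)] Z(2)] by blast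
  have "{y \<in> V. (z, y) \<in> E} \<subseteq> insert u {y \<in> Z. (z, y) \<in> E}"
    using noarc[OF z(1)] by (auto simp: Y_def)
  then have "card {y \<in> V. (z, y) \<in> E} \<le> card (insert u {y \<in> Z. (z, y) \<in> E})"
    using finZ by (intro card_mono) auto
  also have "\<dots> \<le> Suc (card {y \<in> Z. (z, y) \<in> E})" by (rule card_insert_le_m1) auto
  finally have 1: "2 * d \<le> card Z + 1" using out[of z] z ZV by fastforce
  obtain y where y: "y \<in> Y" "2 * card {z \<in> Y. (z, y) \<in> E} + 1 \<le> card Y"
    using exists_low_in_degree[OF tour_subset[OF V(1) ZV(2)] ZV(3)] by blast
  have "{x \<in> V. (x, y) \<in> E} \<subseteq> insert u {z \<in> Y. (z, y) \<in> E}"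
    using noarc[OF _ y(1)] by (auto simp: Y_def)
  then have "card {x \<in> V. (x, y) \<in> E} \<le> card (insert u {z \<in> Y. (z, y) \<in> E})"
    using finZ by (intro card_mono) auto
  also have "\<dots> \<le> Suc (card {z \<in> Y. (z, y) \<in> E})" by (rule card_insert_le_m1) auto
  finally have 2: "2 * d \<le> card Y + 1" using ind[of y] y ZV by fastforce
  have "V = insert u (Z \<union> Y)" "u \<notin> Z \<union> Y" "Z \<inter> Y = {}" using Z(1) V(2) by (auto simp: Y_def)
  then have "card V = Suc (card Z + card Y)"
    using finZ by (metis card_Un_disjoint card_insert_disjoint finite_Un)
  with 1 2 d show False by linarith
qed

section \<open>Existence of many disjoint paths\<close>

text \<open>Each path then uses up only one vertex of \<open>S\<close> and one of \<open>R\<close>,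
  which keeps the uncovered parts of both large.\<close>

definition tight :: "'a set \<Rightarrow> 'a set \<Rightarrow> 'a list set \<Rightarrow> bool" where
  "tight S R F \<longleftrightarrow> (\<forall>P\<in>F. set (tl P) \<inter> S = {} \<and> set (butlast P) \<inter> R = {})"

lemma tightD:
  assumes "tight S R F" "P \<in> F"
  shows "set (tl P) \<inter> S = {}" "set (butlast P) \<inter> R = {}"
  using assms by (simp_all add: tight_def)

lemma path_system_card_le:
  assumes F: "path_system X E S R F"
  shows "inj_on hd F" "card F \<le> card (cover F)"
proof -
  have hd: "hd P \<in> set P" if "P \<in> F" for P
    using path_betweenD(1)[OF path_systemD(2)[OF F that]] by simp
  show inj: "inj_on hd F"
    using hd path_systemD(3)[OF F] unfolding inj_on_def by (metis disjoint_iff)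
  have "hd ` F \<subseteq> cover F" using hd by blast
  moreover have "finite (cover F)" using path_systemD(1)[OF F] by simp
  ultimately show "card F \<le> card (cover F)"
    using card_image[OF inj] card_mono by metis
qed

text \<open>A tight system with the maximal number of paths leaves sets \<open>B \<subseteq> S\<close> and \<open>C \<subseteq> R\<close> uncovered.
  On a path of the system, no vertex with an arc into \<open>C\<close> precedes a vertex with an arc from \<open>B\<close>,
  as otherwise the path could be replaced by two. So at most one vertex per path is of both kinds,
  and adding the out-degree of a vertex of \<open>B\<close> to the in-degree of one of \<open>C\<close> bounds the minimal
  degree from above.\<close>

lemma exists_large_path_system:
  assumes V: "tour V E" "u \<in> V" "v \<in> V" "u \<noteq> v"
    and out: "\<And>x. x \<in> V \<Longrightarrow> d \<le> card {y \<in> V. (x, y) \<in> E}"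
    and ind: "\<And>x. x \<in> V \<Longrightarrow> d \<le> card {y \<in> V. (y, x) \<in> E}"
    and m: "m < d" "2 * card V + 4 * m < 6 * d + 8"
  defines "X \<equiv> V - {u, v}"
  defines "S \<equiv> {x \<in> X. (u, x) \<in> E}" and "R \<equiv> {x \<in> X. (x, v) \<in> E}"
  shows "\<exists>F. path_system X E S R F \<and> m \<le> card F"
proof (rule ccontr)
  assume neg: "\<not> ?thesis"
  have finV: "finite V" by (rule tour_finite[OF V(1)])
  then have finX: "finite X" by (simp add: X_def)
  have X: "tour X E" by (rule tour_subset[OF V(1)]) (auto simp: X_def)
  have SR: "S \<subseteq> X" "R \<subseteq> X" by (auto simp: S_def R_def)
  have "path_system X E S R {} \<and> tight S R {}" by (simp add: path_system_def tight_def)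
  moreover have "card F < Suc (card X)" if "path_system X E S R F \<and> tight S R F" for F
    using path_system_card_le(2)[of X E S R F] path_system_cover_subset[of X E S R F]
      card_mono[OF finX, of "cover F"] that by linarith
  ultimately obtain F where F: "path_system X E S R F" "tight S R F"
    and maxF: "\<And>F'. path_system X E S R F' \<Longrightarrow> tight S R F' \<Longrightarrow> card F' \<le> card F"
    using ex_has_greatest_nat[of "\<lambda>F. path_system X E S R F \<and> tight S R F" "{}" card
        "Suc (card X)"] by blast
  let ?N = "card F"
  define U where "U = cover F"
  define B where "B = S - U"
  define C where "C = R - U"
  define D where "D = X - U - S - R"
  have Nm: "?N < m" using neg F(1) by force
  have pb: "path_between X E S R P" if "P \<in> F" for P
    using path_systemD(2)[OF F(1) that] .
  have UX: "U \<subseteq> X" using path_system_cover_subset[OF F(1)] by (simp add: U_def)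
  \<comment> \<open>A tight path outside \<open>U\<close> could be added. This is applied to
    \<open>[x]\<close>, \<open>[b, c]\<close> and \<open>[b, x, c]\<close>.\<close>
  have noext: False
    if "path_between X E S R Q" "set (tl Q) \<inter> S = {}" "set (butlast Q) \<inter> R = {}" "set Q \<inter> U = {}"
    for Q
  proof -
    have disj: "set Q \<inter> cover (F - {}) = {}" using that(4) by (simp add: U_def)
    note ex = path_system_exchange[OF F(1) empty_subsetI that(1) disj]
    have "tight S R (insert Q (F - {}))" using F(2) that(2,3) by (simp add: tight_def)
    from maxF[OF ex(1) this] show False using ex(2) by simp
  qed
  have BC: "x \<notin> C" if "x \<in> B" for x
  proof
    assume "x \<in> C"
    show False
      by (rule noext[of "[x]"]) (use that \<open>x \<in> C\<close> SR in \<open>auto simp: path_between_def B_def C_def\<close>)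
  qed
  have BS: "b \<in> S" "b \<in> X" "b \<notin> U" "b \<notin> R" if "b \<in> B" for b
    using that SR BC[OF that] by (auto simp: B_def C_def)
  have CR: "c \<in> R" "c \<in> X" "c \<notin> U" "c \<notin> S" if "c \<in> C" for c
    using that SR BC[of c] by (auto simp: B_def C_def)
  have no_bc: "(b, c) \<notin> E" if "b \<in> B" "c \<in> C" for b c
  proof
    assume "(b, c) \<in> E"
    moreover have "b \<noteq> c" using that BC by blast
    ultimately show False
      using noext[of "[b, c]"] BS[OF that(1)] CR[OF that(2)] by (simp add: path_between_def)
  qed
  have no_bdc: "\<not> ((b, x) \<in> E \<and> (x, c) \<in> E)" if "b \<in> B" "x \<in> D" "c \<in> C" for b x c
  proof
    assume "(b, x) \<in> E \<and> (x, c) \<in> E"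
    moreover have "b \<noteq> c" using that BC by blast
    moreover have "x \<in> X" "x \<notin> S" "x \<notin> R" "x \<notin> U" using that(2) by (simp_all add: D_def)
    moreover from this have "x \<noteq> b" "x \<noteq> c" using BS[OF that(1)] CR[OF that(3)] by blast+
    ultimately show False
      using noext[of "[b, x, c]"] BS[OF that(1)] CR[OF that(3)] by (simp add: path_between_def)
  qed
  \<comment> \<open>Within \<open>X\<close>, by \<open>no_bc\<close>, these are the out-neighbours
    of \<open>B\<close> outside \<open>B\<close> and the in-neighbours of \<open>C\<close> outside
    \<open>C\<close>.\<close>
  define H1 where "H1 = {x \<in> U \<union> D. \<exists>b\<in>B. (b, x) \<in> E}"
  define H2 where "H2 = {x \<in> U \<union> D. \<exists>c\<in>C. (x, c) \<in> E}"
  have augment: False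
    if P: "ys @ x # z1 @ y # z2 \<in> F" and x: "x \<in> H2" and y: "y \<in> H1" for ys x z1 y z2
  proof -
    let ?P = "ys @ x # z1 @ y # z2"
    obtain b where b: "b \<in> B" "(b, y) \<in> E" using y by (auto simp: H1_def)
    obtain c where c: "c \<in> C" "(x, c) \<in> E" using x by (auto simp: H2_def)
    note d = path_betweenD[OF pb[OF P]]
    note t = tightD[OF F(2) P]
    have PU: "set ?P \<subseteq> U" unfolding U_def using P by blast
    have bc: "b \<noteq> c" using b c BC by blast
    \<comment> \<open>The beginning now leaves to \<open>c\<close>, the end is entered from
      \<open>b\<close>, and \<open>z1\<close> becomes uncovered.\<close>
    let ?Q1 = "ys @ [x, c]" and ?Q2 = "b # y # z2"
    have G: "{?P} \<subseteq> F" using P by simp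
    have cov: "cover (F - {?P}) = U - set ?P"
      using path_system_cover_Diff[OF F(1) G] by (simp add: U_def)
    have w1: "walk E ?Q1" and w2: "walk E ?Q2"
      using d(4) c(2) b(2) by (auto simp: successively_append_iff successively_Cons)
    have hd1: "hd ?Q1 = hd ?P" by (cases ys) simp_all
    have Q1: "path_between X E S R ?Q1"
      unfolding path_between_def hd1
      using w1 d CR[OF c(1)] PU by auto
    have Q2: "path_between X E S R ?Q2"
      unfolding path_between_def
      using w2 d BS[OF b(1)] PU by auto
    have disj1: "set ?Q1 \<inter> cover (F - {?P}) = {}"
      unfolding cov using CR(3)[OF c(1)] by auto
    \<comment> \<open>This exchange puts \<open>?Q1\<close> in place of \<open>?P\<close>; the next
      one adds \<open>?Q2\<close>, so there is one path more.\<close>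
    note ex1 = path_system_exchange[OF F(1) G Q1 disj1]
    have cov1: "cover (insert ?Q1 (F - {?P})) = set ?Q1 \<union> (U - set ?P)"
      using cov by simp
    have disj2: "set ?Q2 \<inter> cover (insert ?Q1 (F - {?P}) - {}) = {}"
      using cov1 BS(3)[OF b(1)] CR(3)[OF c(1)] d(2) bc PU by auto
    note ex2 = path_system_exchange[OF ex1(1) empty_subsetI Q2 disj2]
    have "set (tl ?Q1) \<inter> S = {}"
      using t(1) CR(4)[OF c(1)] by (cases ys) auto
    moreover have "set (butlast ?Q1) \<inter> R = {}"
      using t(2) by (auto simp: butlast_append)
    moreover have "set (tl ?Q2) \<inter> S = {}"
      using t(1) by (cases ys) auto
    moreover have "set (butlast ?Q2) \<inter> R = {}"
      using t(2) BS(4)[OF b(1)] by (auto simp: butlast_append split: if_splits)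
    ultimately have "tight S R (insert ?Q2 (insert ?Q1 (F - {?P}) - {}))"
      using F(2) by (simp add: tight_def)
    from maxF[OF ex2(1) this] have "card (insert ?Q1 (F - {?P})) + 1 \<le> ?N"
      using ex2(2) by simp
    moreover have "?N \<ge> 1" using P path_systemD(1)[OF F(1)]
      by (metis One_nat_def Suc_leI card_gt_0_iff empty_iff)
    ultimately show False using ex1(2) by simp
  qed
  have H12U: "H1 \<inter> H2 \<subseteq> U" using no_bdc by (auto simp: H1_def H2_def)
  have "\<forall>x\<in>H1 \<inter> H2. \<exists>P. P \<in> F \<and> x \<in> set P" using H12U by (auto simp: U_def)
  then obtain f where f: "\<And>x. x \<in> H1 \<inter> H2 \<Longrightarrow> f x \<in> F \<and> x \<in> set (f x)" by metis
  have "inj_on f (H1 \<inter> H2)"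
  proof (rule inj_onI, rule ccontr)
    fix x y assume xy: "x \<in> H1 \<inter> H2" "y \<in> H1 \<inter> H2" "f x = f y" "x \<noteq> y"
    have P: "f x \<in> F" "x \<in> set (f x)" "y \<in> set (f x)" using f xy by metis+
    obtain ys zs where s: "f x = ys @ x # zs" using P(2) by (meson split_list)
    show False
    proof (cases "y \<in> set zs")
      case True
      then obtain z1 z2 where "zs = z1 @ y # z2" by (meson split_list)
      then show False using augment[of ys x z1 y z2] P(1) s xy by simp
    next
      case False
      then have "y \<in> set ys" using P(3) s xy(4) by simp
      then obtain z1 z2 where "ys = z1 @ y # z2" by (meson split_list)
      then show False using augment[of z1 y z2 x zs] P(1) s xy by simp
    qed
  qed
  then have cH: "card (H1 \<inter> H2) \<le> ?N"
    by (rule card_inj_on_le) (use f path_systemD(1)[OF F(1)] in auto)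
  have "finite U" "finite S" "finite R"
    using finX UX SR finite_subset by blast+
  then have fin: "finite U" "finite B" "finite C" "finite D" "finite S" "finite R"
    using finX by (simp_all add: B_def C_def D_def)
  have finH: "finite H1" "finite H2" using fin by (auto simp: H1_def H2_def)
  have "card (H1 \<union> H2) \<le> card (U \<union> D)"
    using fin by (intro card_mono) (auto simp: H1_def H2_def)
  then have H: "card H1 + card H2 \<le> card (U \<union> D) + ?N"
    using card_Un_Int[OF finH] cH by simp
  \<comment> \<open>The only out-neighbour of \<open>u\<close> that \<open>S\<close> can miss is
    \<open>v\<close>.\<close>
  have dS: "d \<le> card S + 1"
  proof -
    have "{y \<in> V. (u, y) \<in> E} \<subseteq> insert v S"
      using V unfolding S_def X_def tour_def by blast
    then have "card {y \<in> V. (u, y) \<in> E} \<le> card (insert v S)" using fin by (intro card_mono) auto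
    also have "\<dots> \<le> Suc (card S)" by (rule card_insert_le_m1) auto
    finally show ?thesis using out[OF V(2)] by linarith
  qed
  have dR: "d \<le> card R + 1"
  proof -
    have "{y \<in> V. (y, v) \<in> E} \<subseteq> insert u R"
      using V unfolding R_def X_def tour_def by blast
    then have "card {y \<in> V. (y, v) \<in> E} \<le> card (insert u R)" using fin by (intro card_mono) auto
    also have "\<dots> \<le> Suc (card R)" by (rule card_insert_le_m1) auto
    finally show ?thesis using ind[OF V(3)] by linarith
  qed
  have "S \<inter> U \<subseteq> hd ` F"
  proof
    fix x assume "x \<in> S \<inter> U"
    then obtain P where P: "P \<in> F" "x \<in> set P" "x \<in> S" by (auto simp: U_def)
    then have "x = hd P" using tightD(1)[OF F(2) P(1)] by (cases P) auto
    then show "x \<in> hd ` F" using P(1) by blast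
  qed
  then have "card (S \<inter> U) \<le> ?N" using path_systemD(1)[OF F(1)] by (rule surj_card_le[rotated])
  moreover have "card S = card (S \<inter> U) + card B"
    using fin card_Int_Diff[of S U] by (simp add: B_def)
  ultimately have cB: "d \<le> card B + ?N + 1" using dS by linarith
  have "R \<inter> U \<subseteq> last ` F"
  proof
    fix x assume "x \<in> R \<inter> U"
    then obtain P where P: "P \<in> F" "x \<in> set P" "x \<in> R" by (auto simp: U_def)
    then have "x = last P" using tightD(2)[OF F(2) P(1)] by (cases P rule: rev_cases) auto
    then show "x \<in> last ` F" using P(1) by blast
  qed
  then have "card (R \<inter> U) \<le> ?N" using path_systemD(1)[OF F(1)] by (rule surj_card_le[rotated])
  moreover have "card R = card (R \<inter> U) + card C"
    using fin card_Int_Diff[of R U] by (simp add: C_def)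
  ultimately have cC: "d \<le> card C + ?N + 1" using dR by linarith
  have ne: "B \<noteq> {}" "C \<noteq> {}" using cB cC Nm m(1) by auto
  have sub: "B \<subseteq> V" "C \<subseteq> V" using BS(2) CR(2) by (auto simp: X_def)
  obtain z where z: "z \<in> B" "2 * card {y \<in> B. (z, y) \<in> E} + 1 \<le> card B"
    using exists_low_out_degree[OF tour_subset[OF V(1) sub(1)] ne(1)] by blast
  have zV: "z \<in> V" using z(1) sub by blast
  \<comment> \<open>\<open>z\<close> has no arc to \<open>u\<close>, which dominates it, none to
    \<open>v\<close>, as \<open>z\<close> is not in \<open>R\<close>, and none into
    \<open>C\<close>.\<close>
  have "{y \<in> V. (z, y) \<in> E} \<subseteq> {y \<in> B. (z, y) \<in> E} \<union> H1"
  proof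
    fix y assume "y \<in> {y \<in> V. (z, y) \<in> E}"
    then have y: "y \<in> V" "(z, y) \<in> E" by auto
    have "(u, z) \<in> E" "(z, v) \<notin> E" "z \<noteq> u" using BS[OF z(1)] by (auto simp: S_def R_def X_def)
    then have "y \<in> X" using y tour_arc_iff[OF V(1), of u z] V(2) zV by (auto simp: X_def)
    moreover have "y \<notin> C" using no_bc[OF z(1)] y(2) by blast
    ultimately have "y \<in> U \<union> D \<union> B" by (auto simp: B_def C_def D_def)
    then show "y \<in> {y \<in> B. (z, y) \<in> E} \<union> H1" using y z(1) by (auto simp: H1_def)
  qed
  then have "card {y \<in> V. (z, y) \<in> E} \<le> card ({y \<in> B. (z, y) \<in> E} \<union> H1)"
    using fin finH by (intro card_mono) auto
  also have "\<dots> \<le> card {y \<in> B. (z, y) \<in> E} + card H1" by (rule card_Un_le)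
  finally have 1: "2 * d + 1 \<le> card B + 2 * card H1" using out[OF zV] z(2) by linarith
  obtain w where w: "w \<in> C" "2 * card {y \<in> C. (y, w) \<in> E} + 1 \<le> card C"
    using exists_low_in_degree[OF tour_subset[OF V(1) sub(2)] ne(2)] by blast
  have wV: "w \<in> V" using w(1) sub by blast
  have "{y \<in> V. (y, w) \<in> E} \<subseteq> {y \<in> C. (y, w) \<in> E} \<union> H2"
  proof
    fix y assume "y \<in> {y \<in> V. (y, w) \<in> E}"
    then have y: "y \<in> V" "(y, w) \<in> E" by auto
    have "(w, v) \<in> E" "(u, w) \<notin> E" "w \<noteq> v" using CR[OF w(1)] by (auto simp: S_def R_def X_def)
    then have "y \<in> X" using y tour_arc_iff[OF V(1), of w v] V(3) wV by (auto simp: X_def)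
    moreover have "y \<notin> B" using no_bc[OF _ w(1)] y(2) by blast
    ultimately have "y \<in> U \<union> D \<union> C" by (auto simp: B_def C_def D_def)
    then show "y \<in> {y \<in> C. (y, w) \<in> E} \<union> H2" using y w(1) by (auto simp: H2_def)
  qed
  then have "card {y \<in> V. (y, w) \<in> E} \<le> card ({y \<in> C. (y, w) \<in> E} \<union> H2)"
    using fin finH by (intro card_mono) auto
  also have "\<dots> \<le> card {y \<in> C. (y, w) \<in> E} + card H2" by (rule card_Un_le)
  finally have 2: "2 * d + 1 \<le> card C + 2 * card H2" using ind[OF wV] w(2) by linarith
  have "X = (U \<union> D) \<union> (B \<union> C)" using UX SR by (auto simp: B_def C_def D_def)
  moreover have "(U \<union> D) \<inter> (B \<union> C) = {}" by (auto simp: B_def C_def D_def)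
  moreover have "B \<inter> C = {}" using BC by blast
  ultimately have "card X = card (U \<union> D) + (card B + card C)"
    using fin by (simp add: card_Un_disjoint)
  moreover have "card X + 2 = card V"
    using finV V card_Diff_subset[of "{u, v}" V] card_mono[of V "{u, v}"] by (simp add: X_def)
  \<comment> \<open>Adding \<open>1\<close> and \<open>2\<close>, bounding
    \<open>card H1 + card H2\<close> by \<open>H\<close> and \<open>card B + card C\<close> from
    below by \<open>cB\<close> and \<open>cC\<close> gives
    \<open>6 * d + 4 \<le> 2 * card V + 4 * ?N\<close>. As \<open>?N \<le> m - 1\<close>, this
    contradicts \<open>m(2)\<close>.\<close>
  ultimately show False using 1 2 H cB cC Nm m(2) by linarith
qed

section \<open>Containers and the numerical conditions\<close>

text \<open>Each \<open>P\<close> becomes \<open>u # P @ [v]\<close>, whose internal vertices are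
  exactly \<open>set P\<close>. As \<open>1 \<le> w\<close>, some path covers \<open>u\<close> and
  \<open>v\<close>.\<close>

lemma container_from_path_system:
  assumes u: "u \<in> V" "v \<in> V" "u \<noteq> v"
    and F: "path_system (V - {u, v}) E {x \<in> V - {u, v}. (u, x) \<in> E}
              {x \<in> V - {u, v}. (x, v) \<in> E} F"
    and cov: "cover F = V - {u, v}" and card: "card F = w" "1 \<le> w"
  shows "\<exists>Ps. container_from V E w u v Ps"
proof -
  obtain xs where xs: "set xs = F" "distinct xs"
    using finite_distinct_list[OF path_systemD(1)[OF F]] by blast
  then have len: "length xs = w" using card(1) distinct_card by metis
  let ?f = "\<lambda>P. u # P @ [v]"
  have iv: "internal_vertices (?f P) = set P" for P
    by (simp add: internal_vertices_def butlast_append)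
  have path: "is_path V E u v (?f P)" if "P \<in> F" for P
  proof -
    note d = path_betweenD[OF path_systemD(2)[OF F that]]
    have "walk E (?f P)"
      using d by (auto simp: successively_Cons successively_append_iff)
    then show ?thesis
      using d u unfolding is_path_def successively_conv_nth by auto
  qed
  have "internal_vertices (map ?f xs ! i) \<inter> internal_vertices (map ?f xs ! j) = {}"
    if "i < w" "j < w" "i \<noteq> j" for i j
  proof -
    have "xs ! i \<noteq> xs ! j" using xs(2) that len by (simp add: nth_eq_iff_index_eq)
    moreover have "xs ! i \<in> F" "xs ! j \<in> F" using xs(1) that len nth_mem by metis+
    ultimately have "set (xs ! i) \<inter> set (xs ! j) = {}" using path_systemD(3)[OF F] by blast
    then show ?thesis using that len iv by simp
  qed
  moreover have "(\<Union>p\<in>set (map ?f xs). set p) = V"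
  proof -
    have "F \<noteq> {}" using card by auto
    then have "(\<Union>p\<in>set (map ?f xs). set p) = {u, v} \<union> cover F" using xs(1) by auto
    then show ?thesis using cov u by auto
  qed
  moreover have "distinct (map ?f xs)" using xs(2) by (simp add: distinct_map inj_on_def)
  ultimately have "container_from V E w u v (map ?f xs)"
    unfolding container_from_def using len xs(1) path by auto
  then show ?thesis by blast
qed

text \<open>The two degrees add up to \<open>card V - 1\<close> and differ by at most
  \<open>k\<close>; half of \<open>card V - 1 - k\<close>, rounded up, is
  \<open>(card V - k) div 2\<close>.\<close>

lemma degree_lower_bounds:
  assumes V: "tournament V E" and k: "irregularity V E \<le> k" and x: "x \<in> V"
  shows "(card V - k) div 2 \<le> card {y \<in> V. (x, y) \<in> E}"
    and "(card V - k) div 2 \<le> card {y \<in> V. (y, x) \<in> E}"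
proof -
  note T = tour_if_tournament[OF V]
  note sum = tour_degree_sum[OF T x]
  have "finite V" by (rule tour_finite[OF T])
  then have "nat \<bar>int (out_deg V E x) - int (in_deg V E x)\<bar> \<le> irregularity V E"
    unfolding irregularity_def using x by (intro Max_ge) auto
  then have "\<bar>int (card {y \<in> V. (x, y) \<in> E}) - int (card {y \<in> V. (y, x) \<in> E})\<bar> \<le> int k"
    using k by (simp add: out_deg_def in_deg_def)
  with sum show "(card V - k) div 2 \<le> card {y \<in> V. (x, y) \<in> E}"
    and "(card V - k) div 2 \<le> card {y \<in> V. (y, x) \<in> E}" by linarith+
qed

theorem theorem4p2:
  fixes V :: "'a set" and E :: "('a \<times> 'a) set" and k t :: nat
  assumes "tournament V E"
    and "t \<ge> 2"
    and "irregularity V E \<le> k"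
    and "card V \<ge> 6 * t + 5 * k"
  shows "\<forall>\<omega>. 1 \<le> \<omega> \<and> \<omega> \<le> t \<longrightarrow> k_strongly_connected V E \<omega>"
proof (intro allI impI)
  fix w assume w: "1 \<le> w \<and> w \<le> t"
  define d where "d = (card V - k) div 2"
  note deg = degree_lower_bounds[OF assms(1,3), folded d_def]
  have d: "card V \<le> 2 * d + k + 1" unfolding d_def by linarith
  have V: "tour V E" by (rule tour_if_tournament[OF assms(1)])
  show "k_strongly_connected V E w"
    unfolding k_strongly_connected_def strong_container_def
  \<comment> \<open>The paths can always be chosen from \<open>u\<close> to \<open>v\<close>,
    whichever way the arc between them points.\<close>
  proof (intro ballI impI disjI1)
    fix u v assume uv: "u \<in> V" "v \<in> V" "u \<noteq> v"
    let ?X = "V - {u, v}"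
    let ?S = "{x \<in> ?X. (u, x) \<in> E}" and ?R = "{x \<in> ?X. (x, v) \<in> E}"
    have d4: "card V + 1 < 4 * d" using d assms(2,4) by linarith
    have absR: "absorbing ?X E ?R"
      by (rule absorbing_if_min_degree[OF V uv deg d4])
    \<comment> \<open>The same lemma for the reversed arcs, with \<open>u\<close> and
      \<open>v\<close> exchanged.\<close>
    have "absorbing (V - {v, u}) (E\<inverse>) {x \<in> V - {v, u}. (x, u) \<in> E\<inverse>}"
      by (rule absorbing_if_min_degree[OF tour_converse[OF V] uv(2,1) _ _ _ d4])
        (use uv deg in auto)
    then have absS: "absorbing ?X (E\<inverse>) ?S" by (simp add: insert_commute)
    \<comment> \<open>For the second bound below, \<open>card V > 4 * w + 3 * k + 3\<close>
      suffices; it holds since \<open>t \<ge> 2\<close> gives \<open>2 * t > 3\<close>.\<close>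
    have "3 * card V \<le> 6 * d + 3 * k + 3" "w \<le> t" using d w by linarith+
    then have "w + 2 < d" and "2 * card V + 4 * w < 6 * d"
      using assms(2,4) by linarith+
    then have "w + 2 < d" and "2 * card V + 4 * (w + 2) < 6 * d + 8" by simp_all
    from exists_large_path_system[OF V uv deg this]
    obtain F0 where F0: "path_system ?X E ?S ?R F0" "w + 2 \<le> card F0" by blast
    from w have w1: "1 \<le> w" by simp
    from spanning_path_system[OF tour_subset[OF V Diff_subset] absR absS F0 w1]
    obtain F where F: "path_system ?X E ?S ?R F" "cover F = ?X" "card F = w" by blast
    show "\<exists>Ps. container_from V E w u v Ps"
      by (rule container_from_path_system[OF uv F w1])
  qed
qed

end
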